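(* Let $\lambda>0$ and $T>0$, and let $\sigma:\mathbb{R}\to[0,\infty)$ be a non-negative $T$-periodic function with $\sigma|_{[0,T]}\in L^1[0,T]$. Let $\bar{\sigma}=\frac{1}{T}\int_0^T\sigma(t)\,dt$, let $x_p$ be the unique $T$-periodic solution of $x'(t)=\sigma(t)(1-x(t))-\lambda x(t)$, and let $w[\sigma]=\lambda\cdot\frac{1}{T}\int_0^T x_p(t)\,dt$. Then $$w[\sigma]\leq w[\bar{\sigma}]=\frac{\lambda\bar{\sigma}}{\lambda+\bar{\sigma}},$$ and equality $w[\sigma]=w[\bar\sigma]$ holds only when $\sigma(t)=\bar{\sigma}$ for almost every $t$.
   Context: Solutions of the differential equation $x'(t)=\sigma(t)(1-x(t))-\lambda x(t)$ are understood in the Carathéodory sense: $x$ is (locally) absolutely continuous and satisfies the equation for almost every $t$. The equation models a system with a bottleneck entrance, where $x\in[0,1]$ is the occupancy, $\sigma(t)\ge 0$ the inflow rate, and $\lambda x$ the output rate. The notation $w[\bar\sigma]$ means the functional $w$ evaluated at the constant inflow rate equal to $\bar\sigma$, for which the periodic solution is the constant $\frac{\bar\sigma}{\lambda+\bar\sigma}$. *)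

theory Defs
  imports "HOL-Analysis.Analysis"
begin

(* Absolute continuity on [a, b] in the epsilon-delta sense, over finite families of
   pairwise non-overlapping subintervals. *)
definition abs_continuous_on_interval :: "real \<Rightarrow> real \<Rightarrow> (real \<Rightarrow> real) \<Rightarrow> bool" where
  "abs_continuous_on_interval a b f \<longleftrightarrow>
     (\<forall>\<epsilon>>0. \<exists>\<delta>>0. \<forall>(n::nat) (u::nat \<Rightarrow> real) (v::nat \<Rightarrow> real).
        (\<forall>i<n. a \<le> u i \<and> u i \<le> v i \<and> v i \<le> b) \<and>
        disjoint_family_on (\<lambda>i. {u i<..<v i}) {..<n} \<and>
        (\<Sum>i<n. v i - u i) < \<delta>
        \<longrightarrow> (\<Sum>i<n. \<bar>f (v i) - f (u i)\<bar>) < \<epsilon>)"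

definition locally_abs_continuous :: "(real \<Rightarrow> real) \<Rightarrow> bool" where
  "locally_abs_continuous f \<longleftrightarrow> (\<forall>a b. a \<le> b \<longrightarrow> abs_continuous_on_interval a b f)"

(* x' = sigma (1 - x) - lam x on the whole real line, in the Caratheodory sense *)
definition bottleneck_solution :: "real \<Rightarrow> (real \<Rightarrow> real) \<Rightarrow> (real \<Rightarrow> real) \<Rightarrow> bool" where
  "bottleneck_solution lam \<sigma> x \<longleftrightarrow>
     locally_abs_continuous x \<and>
     (AE t in lebesgue. (x has_real_derivative \<sigma> t * (1 - x t) - lam * x t) (at t))"

definition periodic_solution ::
    "real \<Rightarrow> real \<Rightarrow> (real \<Rightarrow> real) \<Rightarrow> (real \<Rightarrow> real) \<Rightarrow> bool" where
  "periodic_solution lam T \<sigma> x \<longleftrightarrow>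
     bottleneck_solution lam \<sigma> x \<and> (\<forall>t. x (t + T) = x t)"

definition x_p :: "real \<Rightarrow> real \<Rightarrow> (real \<Rightarrow> real) \<Rightarrow> real \<Rightarrow> real" where
  "x_p lam T \<sigma> = (THE x. periodic_solution lam T \<sigma> x)"

definition period_mean :: "real \<Rightarrow> (real \<Rightarrow> real) \<Rightarrow> real" where
  "period_mean T f = 1 / T * (LINT t:{0..T}|lebesgue. f t)"

definition w :: "real \<Rightarrow> real \<Rightarrow> (real \<Rightarrow> real) \<Rightarrow> real" where
  "w lam T \<sigma> = lam * period_mean T (x_p lam T \<sigma>)"

end

theory Submission
  imports Defs
begin

text \<open>
  Put g = sigma + lam, S a primitive of g and y = 1 - x, so that y' = lam - g y. Variation of constants
  gives y = exp (- S) P with P' = lam exp S, and the initial value making y periodic is positive.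
  Dividing by y and integrating over a period, the logarithm of y drops out, so lam / y and g have the
  same integral over a period. With c = lam / (lam + mean of sigma), the inequality y + c^2 / y >= 2 c
  then says that the mean of y is at least c, with equality only for y = c, in which case the equation
  forces g to be constant.

  For uniqueness, let the difference z of two periodic solutions be positive somewhere. It satisfies
  z' = - g z < 0 almost everywhere to the left of a positive maximum, so it is nonincreasing
  and thus constant there, a contradiction.
\<close>

section \<open>Closure properties of absolute continuity\<close>

text \<open>The definition indexes families by initial segments of the naturals. Transport along a
  bijection allows any finite index set, so that the tagged cells of a division can serve as indices
  later.\<close>

lemma abs_continuous_on_interval_finite:
  assumes "abs_continuous_on_interval a b f" and "\<epsilon> > 0"
  shows "\<exists>\<delta>>0. \<forall>(I :: 'i set) u v. finite I \<and> (\<forall>i\<in>I. a \<le> u i \<and> u i \<le> v i \<and> v i \<le> b) \<and>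
          disjoint_family_on (\<lambda>i. {u i<..<v i}) I \<and> (\<Sum>i\<in>I. v i - u i) < \<delta>
          \<longrightarrow> (\<Sum>i\<in>I. \<bar>f (v i) - f (u i)\<bar>) < \<epsilon>"
proof -
  obtain \<delta> where \<delta>: "\<delta> > 0"
    and *: "\<forall>(n::nat) u v. (\<forall>i<n. a \<le> u i \<and> u i \<le> v i \<and> v i \<le> b) \<and>
        disjoint_family_on (\<lambda>i. {u i<..<v i}) {..<n} \<and> (\<Sum>i<n. v i - u i) < \<delta>
        \<longrightarrow> (\<Sum>i<n. \<bar>f (v i) - f (u i)\<bar>) < \<epsilon>"
    using assms(1)[unfolded abs_continuous_on_interval_def, THEN spec, THEN mp, OF assms(2)] by blast
  show ?thesis
  proof (intro exI[of _ \<delta>] conjI[OF \<delta>] allI impI)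
    fix I :: "'i set" and u v
    assume "finite I \<and> (\<forall>i\<in>I. a \<le> u i \<and> u i \<le> v i \<and> v i \<le> b) \<and>
          disjoint_family_on (\<lambda>i. {u i<..<v i}) I \<and> (\<Sum>i\<in>I. v i - u i) < \<delta>"
    then have I: "finite I" and le: "\<And>i. i \<in> I \<Longrightarrow> a \<le> u i \<and> u i \<le> v i \<and> v i \<le> b"
      and disj: "disjoint_family_on (\<lambda>i. {u i<..<v i}) I" and len: "(\<Sum>i\<in>I. v i - u i) < \<delta>"
      by auto
    obtain h where h: "bij_betw h {..<card I} I"
      using ex_bij_betw_nat_finite[OF I] by (auto simp: atLeast0LessThan)
    have hI: "h i \<in> I" if "i < card I" for i
      using h that by (auto simp: bij_betw_def)
    have "(\<Sum>i<card I. v (h i) - u (h i)) = (\<Sum>i\<in>I. v i - u i)"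
      by (rule sum.reindex_bij_betw[OF h])
    moreover have "disjoint_family_on (\<lambda>i. {u (h i)<..<v (h i)}) {..<card I}"
    proof (unfold disjoint_family_on_def, intro ballI impI)
      fix m n assume mn: "m \<in> {..<card I}" "n \<in> {..<card I}" "m \<noteq> n"
      then have "h m \<noteq> h n"
        using h by (auto simp: bij_betw_def inj_on_def)
      with mn disj hI show "{u (h m)<..<v (h m)} \<inter> {u (h n)<..<v (h n)} = {}"
        by (auto simp only: disjoint_family_on_def lessThan_iff)
    qed
    ultimately have "(\<Sum>i<card I. \<bar>f (v (h i)) - f (u (h i))\<bar>) < \<epsilon>"
      using *[rule_format, of "card I" "\<lambda>i. u (h i)" "\<lambda>i. v (h i)"] le hI len by auto
    then show "(\<Sum>i\<in>I. \<bar>f (v i) - f (u i)\<bar>) < \<epsilon>"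
      using sum.reindex_bij_betw[OF h, of "\<lambda>i. \<bar>f (v i) - f (u i)\<bar>"] by simp
  qed
qed

text \<open>A \<open>\<delta>\<close> that works for \<open>S\<close> and a scaled-down tolerance
  works for \<open>f\<close>. This is how absolute continuity passes from the primitive
  \<open>S\<close> to the solution built from it.\<close>

lemma abs_continuous_on_interval_dominated:
  assumes S: "abs_continuous_on_interval a b S"
    and le: "\<And>u v. \<lbrakk>a \<le> u; u \<le> v; v \<le> b\<rbrakk> \<Longrightarrow> \<bar>f v - f u\<bar> \<le> K * \<bar>S v - S u\<bar>"
  shows "abs_continuous_on_interval a b f"
  unfolding abs_continuous_on_interval_def
proof (intro allI impI)
  fix \<epsilon> :: real assume "\<epsilon> > 0"
  \<comment> \<open>\<open>K\<close> may be zero or negative, so a positive upper bound of it takes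
    its place as divisor of the tolerance.\<close>
  define L where "L = \<bar>K\<bar> + 1"
  have L: "L > 0" "K \<le> L" by (auto simp: L_def)
  obtain \<delta> where "\<delta> > 0"
    and \<delta>: "\<And>(n::nat) u v. (\<forall>i<n. a \<le> u i \<and> u i \<le> v i \<and> v i \<le> b) \<and>
        disjoint_family_on (\<lambda>i. {u i<..<v i}) {..<n} \<and> (\<Sum>i<n. v i - u i) < \<delta>
        \<longrightarrow> (\<Sum>i<n. \<bar>S (v i) - S (u i)\<bar>) < \<epsilon> / L"
    using S[unfolded abs_continuous_on_interval_def, THEN spec, THEN mp, OF divide_pos_pos[OF \<open>\<epsilon> > 0\<close> L(1)]]
    by blast
  have "(\<Sum>i<n. \<bar>f (v i) - f (u i)\<bar>) < \<epsilon>"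
    if H: "(\<forall>i<n. a \<le> u i \<and> u i \<le> v i \<and> v i \<le> b) \<and>
        disjoint_family_on (\<lambda>i. {u i<..<v i}) {..<n} \<and> (\<Sum>i<n. v i - u i) < \<delta>"
    for n :: nat and u v
  proof -
    have "(\<Sum>i<n. \<bar>f (v i) - f (u i)\<bar>) \<le> (\<Sum>i<n. L * \<bar>S (v i) - S (u i)\<bar>)"
    proof (rule sum_mono)
      fix i assume "i \<in> {..<n}"
      then have "\<bar>f (v i) - f (u i)\<bar> \<le> K * \<bar>S (v i) - S (u i)\<bar>"
        using H le by auto
      also have "\<dots> \<le> L * \<bar>S (v i) - S (u i)\<bar>"
        using L by (intro mult_right_mono) auto
      finally show "\<bar>f (v i) - f (u i)\<bar> \<le> L * \<bar>S (v i) - S (u i)\<bar>" .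
    qed
    also have "\<dots> = L * (\<Sum>i<n. \<bar>S (v i) - S (u i)\<bar>)"
      by (simp add: sum_distrib_left)
    also have "\<dots> < \<epsilon>"
      using \<delta>[rule_format, OF H] L(1) by (simp add: field_simps)
    finally show ?thesis .
  qed
  with \<open>\<delta> > 0\<close> show "\<exists>\<delta>>0. \<forall>(n::nat) u v. (\<forall>i<n. a \<le> u i \<and> u i \<le> v i \<and> v i \<le> b) \<and>
        disjoint_family_on (\<lambda>i. {u i<..<v i}) {..<n} \<and> (\<Sum>i<n. v i - u i) < \<delta>
        \<longrightarrow> (\<Sum>i<n. \<bar>f (v i) - f (u i)\<bar>) < \<epsilon>"
    by blast
qed

lemma abs_continuous_on_interval_add:
  assumes f: "abs_continuous_on_interval a b f" and g: "abs_continuous_on_interval a b g"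
  shows "abs_continuous_on_interval a b (\<lambda>t. f t + g t)"
  unfolding abs_continuous_on_interval_def
proof (intro allI impI)
  fix \<epsilon> :: real assume "\<epsilon> > 0"
  then have e2: "\<epsilon> / 2 > 0" by simp
  obtain d1 where d1: "d1 > 0" and D1: "\<And>(n::nat) u v. (\<forall>i<n. a \<le> u i \<and> u i \<le> v i \<and> v i \<le> b) \<and>
        disjoint_family_on (\<lambda>i. {u i<..<v i}) {..<n} \<and> (\<Sum>i<n. v i - u i) < d1
        \<longrightarrow> (\<Sum>i<n. \<bar>f (v i) - f (u i)\<bar>) < \<epsilon> / 2"
    using f[unfolded abs_continuous_on_interval_def, THEN spec, THEN mp, OF e2] by blast
  obtain d2 where d2: "d2 > 0" and D2: "\<And>(n::nat) u v. (\<forall>i<n. a \<le> u i \<and> u i \<le> v i \<and> v i \<le> b) \<and>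
        disjoint_family_on (\<lambda>i. {u i<..<v i}) {..<n} \<and> (\<Sum>i<n. v i - u i) < d2
        \<longrightarrow> (\<Sum>i<n. \<bar>g (v i) - g (u i)\<bar>) < \<epsilon> / 2"
    using g[unfolded abs_continuous_on_interval_def, THEN spec, THEN mp, OF e2] by blast
  show "\<exists>\<delta>>0. \<forall>(n::nat) u v. (\<forall>i<n. a \<le> u i \<and> u i \<le> v i \<and> v i \<le> b) \<and>
        disjoint_family_on (\<lambda>i. {u i<..<v i}) {..<n} \<and> (\<Sum>i<n. v i - u i) < \<delta>
        \<longrightarrow> (\<Sum>i<n. \<bar>f (v i) + g (v i) - (f (u i) + g (u i))\<bar>) < \<epsilon>"
  proof (intro exI[of _ "min d1 d2"] conjI allI impI)
    show "min d1 d2 > 0" using d1 d2 by simp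
    fix n :: nat and u v
    assume H: "(\<forall>i<n. a \<le> u i \<and> u i \<le> v i \<and> v i \<le> b) \<and>
        disjoint_family_on (\<lambda>i. {u i<..<v i}) {..<n} \<and> (\<Sum>i<n. v i - u i) < min d1 d2"
    have "(\<Sum>i<n. \<bar>f (v i) + g (v i) - (f (u i) + g (u i))\<bar>)
        \<le> (\<Sum>i<n. \<bar>f (v i) - f (u i)\<bar> + \<bar>g (v i) - g (u i)\<bar>)"
      by (rule sum_mono) linarith
    also have "\<dots> < \<epsilon>"
      using D1[of n u v] D2[of n u v] H by (simp add: sum.distrib)
    finally show "(\<Sum>i<n. \<bar>f (v i) + g (v i) - (f (u i) + g (u i))\<bar>) < \<epsilon>" .
  qed
qed

lemma abs_continuous_on_interval_diff:
  assumes "abs_continuous_on_interval a b f" "abs_continuous_on_interval a b g"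
  shows "abs_continuous_on_interval a b (\<lambda>t. f t - g t)"
proof -
  have "abs_continuous_on_interval a b (\<lambda>t. - g t)"
    by (rule abs_continuous_on_interval_dominated[OF assms(2), of _ 1]) auto
  from abs_continuous_on_interval_add[OF assms(1) this] show ?thesis by simp
qed

lemma abs_continuous_on_interval_imp_continuous_on:
  assumes "abs_continuous_on_interval a b f"
  shows "continuous_on {a..b} f"
  unfolding continuous_on_iff
proof (intro ballI allI impI)
  fix t \<epsilon> :: real assume t: "t \<in> {a..b}" and "\<epsilon> > 0"
  obtain \<delta> where "\<delta> > 0"
    and \<delta>: "\<forall>(I :: unit set) u v. finite I \<and> (\<forall>i\<in>I. a \<le> u i \<and> u i \<le> v i \<and> v i \<le> b) \<and>
          disjoint_family_on (\<lambda>i. {u i<..<v i}) I \<and> (\<Sum>i\<in>I. v i - u i) < \<delta>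
          \<longrightarrow> (\<Sum>i\<in>I. \<bar>f (v i) - f (u i)\<bar>) < \<epsilon>"
    using abs_continuous_on_interval_finite[OF assms \<open>\<epsilon> > 0\<close>] by blast
  \<comment> \<open>The family consists of the single interval between \<open>s\<close> and
    \<open>t\<close>, indexed by \<open>unit\<close>; \<open>min\<close> and \<open>max\<close>
    cover both orders of the two points.\<close>
  have "\<bar>f (max s t) - f (min s t)\<bar> < \<epsilon>" if "s \<in> {a..b}" "dist s t < \<delta>" for s
    using \<delta>[THEN spec[of _ UNIV], THEN spec, THEN spec, of "\<lambda>_. min s t" "\<lambda>_. max s t"] that t
    by (auto simp: disjoint_family_on_def dist_real_def)
  then have "dist (f s) (f t) < \<epsilon>" if "s \<in> {a..b}" "dist s t < \<delta>" for s
    using that by (cases "s \<le> t") (fastforce simp: dist_real_def max_def min_def abs_minus_commute)+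
  with \<open>\<delta> > 0\<close> show "\<exists>d>0. \<forall>s\<in>{a..b}. dist s t < d \<longrightarrow> dist (f s) (f t) < \<epsilon>"
    by blast
qed

section \<open>Monotonicity from the sign of an almost everywhere derivative\<close>

text \<open>A fine tagged division replaces a covering theorem. Cells tagged off \<open>N\<close>
  add at most \<open>\<epsilon>\<close> times their length to the increment of \<open>f\<close>;
  cells tagged in \<open>N\<close> have total length below \<open>\<delta>\<close>, so absolute
  continuity makes their contribution less than \<open>\<epsilon>\<close>.\<close>

lemma abs_continuous_nonincreasing:
  fixes f :: "real \<Rightarrow> real"
  assumes ac: "abs_continuous_on_interval a b f" and "a \<le> b" and N: "negligible N"
    and der: "\<And>t. t \<in> {a..b} - N \<Longrightarrow> \<exists>D\<le>0. (f has_real_derivative D) (at t)"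
  shows "f b \<le> f a"
proof (rule field_le_epsilon)
  fix e' :: real assume "e' > 0"
  \<comment> \<open>The tolerance pays for both kinds of cells: \<open>\<epsilon> * (b - a)\<close>
    for those tagged off \<open>N\<close> and one more \<open>\<epsilon>\<close> for those tagged in
    \<open>N\<close>. The summand 1 keeps the divisor positive when \<open>a = b\<close>.\<close>
  define \<epsilon> where "\<epsilon> = e' / (b - a + 1)"
  have \<epsilon>: "\<epsilon> > 0" "\<epsilon> * (b - a) + \<epsilon> = e'"
  proof -
    have "\<epsilon> * (b - a + 1) = e'" using \<open>a \<le> b\<close> by (simp add: \<epsilon>_def)
    then show "\<epsilon> * (b - a) + \<epsilon> = e'" by (simp add: algebra_simps)
  qed (use \<open>e' > 0\<close> \<open>a \<le> b\<close> in \<open>simp add: \<epsilon>_def\<close>)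
  obtain \<delta> where "\<delta> > 0"
    and \<delta>: "\<forall>(I :: (real \<times> real set) set) u v. finite I \<and> (\<forall>i\<in>I. a \<le> u i \<and> u i \<le> v i \<and> v i \<le> b) \<and>
          disjoint_family_on (\<lambda>i. {u i<..<v i}) I \<and> (\<Sum>i\<in>I. v i - u i) < \<delta>
          \<longrightarrow> (\<Sum>i\<in>I. \<bar>f (v i) - f (u i)\<bar>) < \<epsilon>"
    using abs_continuous_on_interval_finite[OF ac \<epsilon>(1)] by blast
  have Nn: "N \<in> null_sets lebesgue" and Ns: "N \<in> sets lebesgue"
    using N by (auto simp: negligible_iff_null_sets)
  obtain U where U: "open U" "N \<subseteq> U" "U - N \<in> lmeasurable" "emeasure lebesgue (U - N) < ennreal \<delta>"
    using sets_lebesgue_outer_open[OF Ns \<open>\<delta> > 0\<close>] by metis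
  have Ueq: "U = (U - N) \<union> N" using U(2) by blast
  have Um: "U \<in> lmeasurable"
    by (subst Ueq, rule fmeasurable.Un) (use U N negligible_imp_measurable in auto)
  have "emeasure lebesgue U = emeasure lebesgue (U - N)"
    by (subst Ueq, rule emeasure_Un_null_set) (use U Nn in \<open>auto simp: fmeasurableD\<close>)
  then have "ennreal (measure lebesgue U) < ennreal \<delta>"
    using U(4) Um by (simp add: emeasure_eq_measure2)
  then have Ulen: "measure lebesgue U < \<delta>"
    using ennreal_less_iff[OF measure_nonneg] by blast
  \<comment> \<open>Straddle estimate: on each side of \<open>t\<close> the difference quotient
    stays below \<open>D + \<epsilon>\<close>, hence below \<open>\<epsilon>\<close>. Adding the two
    one-sided bounds controls the increment over any short interval around \<open>t\<close>.\<close>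
  have "\<exists>d>0. \<forall>u v. u \<le> t \<and> t \<le> v \<and> t - d < u \<and> v < t + d \<longrightarrow> f v - f u \<le> \<epsilon> * (v - u)"
    if t: "t \<in> {a..b} - N" for t
  proof -
    obtain D where "D \<le> 0" and D: "(f has_real_derivative D) (at t)" using der t by blast
    then obtain d where "d > 0" and d: "\<And>s. \<lbrakk>s \<noteq> t; \<bar>s - t\<bar> < d\<rbrakk> \<Longrightarrow> \<bar>(f s - f t) / (s - t) - D\<bar> < \<epsilon>"
      using \<epsilon>(1) unfolding has_field_derivative_iff LIM_eq by (auto simp: )
    have up: "f s - f t \<le> \<epsilon> * (s - t)" if "t \<le> s" "s < t + d" for s
    proof (cases "s = t")
      case False
      then have "(f s - f t) / (s - t) \<le> \<epsilon>"
        using d[of s] that \<open>D \<le> 0\<close> by auto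
      then show ?thesis using False that by (simp add: field_simps)
    qed simp
    have dn: "f t - f s \<le> \<epsilon> * (t - s)" if "s \<le> t" "t - d < s" for s
    proof (cases "s = t")
      case False
      then have "(f s - f t) / (s - t) \<le> \<epsilon>"
        using d[of s] that \<open>D \<le> 0\<close> by auto
      then show ?thesis using False that by (simp add: field_simps)
    qed simp
    have "f v - f u \<le> \<epsilon> * (v - u)" if "u \<le> t \<and> t \<le> v \<and> t - d < u \<and> v < t + d" for u v
      using up[of v] dn[of u] that by (simp add: algebra_simps)
    with \<open>d > 0\<close> show ?thesis by blast
  qed
  then obtain d where d: "\<And>t. t \<in> {a..b} - N \<Longrightarrow> d t > 0"
    and slope: "\<And>t u v. \<lbrakk>t \<in> {a..b} - N; u \<le> t; t \<le> v; t - d t < u; v < t + d t\<rbrakk>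
                  \<Longrightarrow> f v - f u \<le> \<epsilon> * (v - u)"
    by metis
  \<comment> \<open>Off N the gauge controls the slope of f; on N it keeps the division inside U, which is so
    small that absolute continuity bounds the increments of f.\<close>
  define \<gamma> where "\<gamma> t = (if t \<in> N then U else if t \<in> {a..b} then ball t (d t) else UNIV)" for t
  have "gauge \<gamma>"
    using U d by (auto simp: gauge_def \<gamma>_def)
  then obtain p where p: "p tagged_division_of {a..b}" "\<gamma> fine p"
    using fine_division_exists_real by metis
  note pD = tagged_division_ofD[OF p(1)]
  have box: "\<exists>u v. K = {u..v} \<and> Inf K = u \<and> Sup K = v \<and> a \<le> u \<and> u \<le> x \<and> x \<le> v \<and> v \<le> b \<and> K \<subseteq> \<gamma> x"
    if xK: "(x, K) \<in> p" for x K
  proof -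
    obtain u v where K: "K = {u..v}" using pD(4)[OF xK] by auto
    moreover have "x \<in> K" "K \<subseteq> {a..b}" "K \<subseteq> \<gamma> x" using pD(2,3)[OF xK] fineD[OF p(2) xK] by auto
    ultimately show ?thesis by (intro exI[of _ u] exI[of _ v]) auto
  qed
  define B where "B = {q \<in> p. fst q \<in> N}"
  define G where "G = p - B"
  have fin: "finite p" "finite B" "finite G" using pD(1) by (auto simp: B_def G_def)
  have pBG: "p = G \<union> B" "G \<inter> B = {}" by (auto simp: B_def G_def)
  let ?F = "\<lambda>q::real \<times> real set. f (Sup (snd q)) - f (Inf (snd q))"
  let ?L = "\<lambda>q::real \<times> real set. Sup (snd q) - Inf (snd q)"
  have Lnn: "?L q \<ge> 0" if "q \<in> p" for q
    using box[of "fst q" "snd q"] that by auto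
  have tot: "sum ?F p = f b - f a" "sum ?L p = b - a"
    using additive_tagged_division_1[OF \<open>a \<le> b\<close> p(1), of f]
      additive_tagged_division_1[OF \<open>a \<le> b\<close> p(1), of "\<lambda>x. x"] by (simp_all add: case_prod_beta)
  have "sum ?F G \<le> (\<Sum>q\<in>G. \<epsilon> * ?L q)"
  proof (rule sum_mono)
    fix q assume q: "q \<in> G"
    obtain x K where xK: "q = (x, K)" by fastforce
    have xKp: "(x, K) \<in> p" and xN: "x \<notin> N" using q xK by (auto simp: G_def B_def)
    obtain u v where uv: "K = {u..v}" "Inf K = u" "Sup K = v" "a \<le> u" "u \<le> x" "x \<le> v" "v \<le> b" "K \<subseteq> \<gamma> x"
      using box[OF xKp] by blast
    have "x \<in> {a..b}" using uv by auto
    then have "{u..v} \<subseteq> ball x (d x)" using uv xN by (simp add: \<gamma>_def)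
    then have "u \<in> ball x (d x)" "v \<in> ball x (d x)" using uv by (meson atLeastAtMost_iff order.refl order_trans subset_iff)+
    then have "f v - f u \<le> \<epsilon> * (v - u)"
      using slope[of x u v] \<open>x \<in> {a..b}\<close> xN uv by (auto simp: dist_real_def)
    then show "?F q \<le> \<epsilon> * ?L q" using xK uv by simp
  qed
  also have "\<dots> = \<epsilon> * sum ?L G" by (simp add: sum_distrib_left)
  also have "\<dots> \<le> \<epsilon> * sum ?L p"
    using \<epsilon>(1) Lnn fin pBG by (intro mult_left_mono sum_mono2) auto
  finally have Gle: "sum ?F G \<le> \<epsilon> * (b - a)" by (simp add: tot)
  \<comment> \<open>Disjointness of the open cells serves twice: absolute continuity asks for it,
    and it makes the lengths in \<open>B\<close> add up to the measure of a union lying inside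
    \<open>U\<close>.\<close>
  have disj: "{Inf (snd q)<..<Sup (snd q)} \<inter> {Inf (snd r)<..<Sup (snd r)} = {}"
    if "q \<in> p" "r \<in> p" "q \<noteq> r" for q r
  proof -
    have "interior (snd q) \<inter> interior (snd r) = {}"
      using pD(5)[of "fst q" "snd q" "fst r" "snd r"] that by simp
    moreover have "snd q = {Inf (snd q)..Sup (snd q)}"
      using box[of "fst q" "snd q"] that by auto
    moreover have "snd r = {Inf (snd r)..Sup (snd r)}"
      using box[of "fst r" "snd r"] that by auto
    ultimately show ?thesis by (metis interior_atLeastAtMost_real)
  qed
  have Bdisj: "disjoint_family_on (\<lambda>q. {Inf (snd q)<..<Sup (snd q)}) B"
    unfolding disjoint_family_on_def using disj by (simp add: B_def)
  have "sum ?L B = (\<Sum>q\<in>B. measure lebesgue {Inf (snd q)<..<Sup (snd q)})"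
    using Lnn by (intro sum.cong refl) (auto simp: B_def)
  also have "\<dots> = measure lebesgue (\<Union>q\<in>B. {Inf (snd q)<..<Sup (snd q)})"
  proof (rule measure_negligible_finite_Union_image[symmetric, OF fin(2)])
    show "{Inf (snd q)<..<Sup (snd q)} \<in> lmeasurable" for q :: "real \<times> real set"
      by (simp add: lmeasurable_interval)
    show "pairwise (\<lambda>q r. negligible ({Inf (snd q)<..<Sup (snd q)} \<inter> {Inf (snd r)<..<Sup (snd r)})) B"
      using disj by (simp add: pairwise_def B_def)
  qed
  also have "\<dots> \<le> measure lebesgue U"
  proof (rule measure_mono_fmeasurable)
    show "(\<Union>q\<in>B. {Inf (snd q)<..<Sup (snd q)}) \<subseteq> U"
    proof
      fix s assume "s \<in> (\<Union>q\<in>B. {Inf (snd q)<..<Sup (snd q)})"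
      then obtain q where q: "q \<in> B" "s \<in> {Inf (snd q)<..<Sup (snd q)}" by blast
      then have "(fst q, snd q) \<in> p" "fst q \<in> N" by (auto simp: B_def)
      from box[OF this(1)] this(2) q(2) show "s \<in> U" by (auto simp: \<gamma>_def)
    qed
    show "(\<Union>q\<in>B. {Inf (snd q)<..<Sup (snd q)}) \<in> sets lebesgue"
      using fin(2) by (intro sets.finite_UN fmeasurableD) (simp_all add: lmeasurable_interval)
  qed (rule Um)
  finally have "sum ?L B < \<delta>" using Ulen by simp
  then have "(\<Sum>q\<in>B. \<bar>?F q\<bar>) < \<epsilon>"
  proof (intro \<delta>[THEN spec, THEN spec, THEN spec, THEN mp] conjI fin(2) Bdisj ballI)
    fix q assume "q \<in> B"
    then have "(fst q, snd q) \<in> p" by (auto simp: B_def)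
    from box[OF this] show "a \<le> Inf (snd q)" "Inf (snd q) \<le> Sup (snd q)" "Sup (snd q) \<le> b" by auto
  qed
  moreover have "sum ?F B \<le> (\<Sum>q\<in>B. \<bar>?F q\<bar>)" by (rule sum_mono) simp
  moreover have "sum ?F p = sum ?F G + sum ?F B"
    unfolding pBG(1) by (rule sum.union_disjoint) (use fin pBG(2) in auto)
  ultimately have "f b - f a \<le> \<epsilon> * (b - a) + \<epsilon>" using Gle tot(1) by linarith
  then show "f b \<le> f a + e'" using \<epsilon>(2) by linarith
qed

section \<open>Primitives of locally integrable functions\<close>

text \<open>Each integrand is cut off to its open interval. At any point at most one cut-off
  function is nonzero, so their sum is dominated by \<open>h\<close>; shared endpoints do not affect
  the integrals.\<close>

lemma sum_integral_disjoint_le: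
  fixes h :: "real \<Rightarrow> real"
  assumes h: "h integrable_on {a..b}" and pos: "\<And>t. t \<in> {a..b} \<Longrightarrow> h t \<ge> 0"
    and uv: "\<And>i. i \<in> I \<Longrightarrow> a \<le> u i \<and> u i \<le> v i \<and> v i \<le> b" and I: "finite I"
    and disj: "disjoint_family_on (\<lambda>i. {u i<..<v i}) I"
  shows "(\<Sum>i\<in>I. integral {u i..v i} h) \<le> integral {a..b} h"
proof -
  define h' where "h' i t = (if t \<in> {u i<..<v i} then h t else 0)" for i t
  have h': "(h' i has_integral integral {u i..v i} h) {a..b}" if "i \<in> I" for i
  proof -
    have "h integrable_on {u i..v i}"
      using integrable_subinterval_real[OF h] uv[OF that] by auto
    then have "(h has_integral integral {u i..v i} h) (cbox (u i) (v i))"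
      by (simp add: integrable_integral)
    from has_integral_restrict_open_subinterval[OF this, of a b] show ?thesis
      using uv[OF that] by (simp add: h'_def[abs_def])
  qed
  have "((\<lambda>t. \<Sum>i\<in>I. h' i t) has_integral (\<Sum>i\<in>I. integral {u i..v i} h)) {a..b}"
    by (rule has_integral_sum[OF I]) (rule h')
  moreover have "(\<Sum>i\<in>I. h' i t) \<le> h t" if t: "t \<in> {a..b}" for t
  proof (cases "\<exists>i\<in>I. t \<in> {u i<..<v i}")
    case True
    then obtain j where j: "j \<in> I" "t \<in> {u j<..<v j}" by blast
    have "t \<notin> {u i<..<v i}" if "i \<in> I" "i \<noteq> j" for i
      using disj j that unfolding disjoint_family_on_def by blast
    then have "(\<Sum>i\<in>I. h' i t) = (\<Sum>i\<in>I. if i = j then h t else 0)"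
      using j by (intro sum.cong refl) (auto simp: h'_def)
    then show ?thesis using j I by simp
  next
    case False
    then have "(\<Sum>i\<in>I. h' i t) = 0" by (intro sum.neutral ballI) (auto simp: h'_def)
    then show ?thesis using pos[OF t] by simp
  qed
  ultimately show ?thesis
    by (rule has_integral_le[OF _ integrable_integral[OF h]])
qed

lemma abs_continuous_primitive:
  fixes g S :: "real \<Rightarrow> real"
  assumes g: "g integrable_on {a..b}" and pos: "\<And>t. g t \<ge> 0"
    and S: "\<And>u v. \<lbrakk>a \<le> u; u \<le> v; v \<le> b\<rbrakk> \<Longrightarrow> S v - S u = integral {u..v} g"
  shows "abs_continuous_on_interval a b S"
proof -
  have gabs: "g absolutely_integrable_on {a..b}"
    using g pos by (auto intro: nonnegative_absolutely_integrable_1)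
  \<comment> \<open>The truncation m k is bounded, hence has a Lipschitz primitive; the rest has small integral.\<close>
  define m where "m k t = min (g t) (real k)" for k :: nat and t
  have m: "m k integrable_on {a..b}" for k
  proof -
    have "(\<lambda>t. min (g t) (real k)) absolutely_integrable_on {a..b}"
      by (intro absolutely_integrable_min_1 gabs absolutely_integrable_continuous_real continuous_on_const)
    then show ?thesis unfolding m_def using set_lebesgue_integral_eq_integral(1) by blast
  qed
  \<comment> \<open>The truncations are dominated by \<open>g\<close> itself, and at each point they
    equal \<open>g\<close> as soon as \<open>k\<close> exceeds the value there.\<close>
  have lim: "(\<lambda>k. integral {a..b} (m k)) \<longlonglongrightarrow> integral {a..b} g"
  proof (rule dominated_convergence(2)[OF m g])
    show "norm (m k t) \<le> g t" for k t
      using pos[of t] by (simp add: m_def)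
    show "(\<lambda>k. m k t) \<longlonglongrightarrow> g t" for t
    proof (rule tendsto_eventually)
      obtain k0 :: nat where "g t \<le> real k0" using real_arch_simple by blast
      then show "\<forall>\<^sub>F k in sequentially. m k t = g t"
        unfolding eventually_sequentially m_def by (intro exI[of _ k0]) auto
    qed
  qed
  have trunc: "\<exists>k. integral {a..b} g - integral {a..b} (m k) < e" if e: "e > 0" for e
  proof -
    obtain k where "norm (integral {a..b} (m k) - integral {a..b} g) < e"
      using LIMSEQ_D[OF lim e] by blast
    then show ?thesis by (intro exI[of _ k]) auto
  qed
  show ?thesis
    unfolding abs_continuous_on_interval_def
  proof (intro allI impI)
    fix \<epsilon> :: real assume "\<epsilon> > 0"
    then obtain k where k: "integral {a..b} g - integral {a..b} (m k) < \<epsilon> / 2"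
      using trunc[of "\<epsilon> / 2"] by auto
    define h where "h t = g t - m k t" for t
    have h: "h integrable_on {a..b}" "\<And>t. h t \<ge> 0" "integral {a..b} h < \<epsilon> / 2"
    proof -
      show "h integrable_on {a..b}" unfolding h_def by (intro integrable_diff g m)
      show "h t \<ge> 0" for t by (simp add: h_def m_def)
      show "integral {a..b} h < \<epsilon> / 2" unfolding h_def using k by (simp add: integral_diff g m)
    qed
    \<comment> \<open>The bounded part has slope at most \<open>k + 1\<close>, so this choice makes
      it contribute at most half of \<open>\<epsilon>\<close>, the other half being left to
      \<open>h\<close>. Using \<open>k + 1\<close> instead of \<open>k\<close> avoids division by
      zero.\<close>
    define \<delta> where "\<delta> = \<epsilon> / (2 * (real k + 1))"
    have "\<delta> > 0" using \<open>\<epsilon> > 0\<close> by (simp add: \<delta>_def)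
    have "(\<Sum>i<n. \<bar>S (v i) - S (u i)\<bar>) < \<epsilon>"
      if H: "(\<forall>i<n. a \<le> u i \<and> u i \<le> v i \<and> v i \<le> b) \<and>
        disjoint_family_on (\<lambda>i. {u i<..<v i}) {..<n} \<and> (\<Sum>i<n. v i - u i) < \<delta>"
      for n :: nat and u v
    proof -
      have "\<bar>S (v i) - S (u i)\<bar> \<le> integral {u i..v i} h + (real k + 1) * (v i - u i)" if "i < n" for i
      proof -
        have i: "a \<le> u i" "u i \<le> v i" "v i \<le> b" using H that by auto
        have gi: "g integrable_on {u i..v i}" and mi: "m k integrable_on {u i..v i}"
          using i by (auto intro: integrable_subinterval_real[OF g] integrable_subinterval_real[OF m])
        have "S (v i) - S (u i) = integral {u i..v i} g" using S i by simp
        moreover have "integral {u i..v i} g \<ge> 0" using gi pos by (simp add: integral_nonneg)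
        moreover have "integral {u i..v i} g = integral {u i..v i} h + integral {u i..v i} (m k)"
          unfolding h_def using gi mi by (simp add: integral_diff)
        moreover have "integral {u i..v i} (m k) \<le> integral {u i..v i} (\<lambda>_. real k + 1)"
          by (rule integral_le[OF mi]) (auto simp: m_def)
        ultimately show ?thesis using i by (simp add: algebra_simps)
      qed
      then have "(\<Sum>i<n. \<bar>S (v i) - S (u i)\<bar>) \<le> (\<Sum>i<n. integral {u i..v i} h + (real k + 1) * (v i - u i))"
        by (intro sum_mono) auto
      also have "\<dots> = (\<Sum>i<n. integral {u i..v i} h) + (real k + 1) * (\<Sum>i<n. v i - u i)"
        by (simp add: sum.distrib sum_distrib_left)
      also have "\<dots> \<le> integral {a..b} h + (real k + 1) * (\<Sum>i<n. v i - u i)"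
        using sum_integral_disjoint_le[OF h(1,2), of "{..<n}" u v] H by auto
      also have "\<dots> \<le> integral {a..b} h + (real k + 1) * \<delta>"
        using H by (intro add_left_mono mult_left_mono) auto
      also have "(real k + 1) * \<delta> = \<epsilon> / 2"
        by (simp add: \<delta>_def nonzero_eq_divide_eq field_simps)
      finally show ?thesis using h(3) by simp
    qed
    with \<open>\<delta> > 0\<close> show "\<exists>\<delta>>0. \<forall>(n::nat) u v. (\<forall>i<n. a \<le> u i \<and> u i \<le> v i \<and> v i \<le> b) \<and>
        disjoint_family_on (\<lambda>i. {u i<..<v i}) {..<n} \<and> (\<Sum>i<n. v i - u i) < \<delta>
        \<longrightarrow> (\<Sum>i<n. \<bar>S (v i) - S (u i)\<bar>) < \<epsilon>"
      by blast
  qed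
qed

lemma primitive_exists:
  fixes g :: "real \<Rightarrow> real"
  assumes g: "\<And>a b. g integrable_on {a..b}"
  obtains S where "S 0 = 0" "\<And>u v. u \<le> v \<Longrightarrow> S v - S u = integral {u..v} g"
proof -
  define S where "S t = (if 0 \<le> t then integral {0..t} g else - integral {t..0} g)" for t :: real
  have "S 0 = 0" by (simp add: S_def)
  moreover have "S v - S u = integral {u..v} g" if "u \<le> v" for u v
  proof -
    have combine: "integral {a..c} g + integral {c..b} g = integral {a..b} g" if "a \<le> c" "c \<le> b" for a b c
      by (rule Henstock_Kurzweil_Integration.integral_combine) (use that g in auto)
    consider "0 \<le> u" | "u < 0" "0 \<le> v" | "v < 0" by linarith
    then show ?thesis
      using that combine[of 0 u v] combine[of u 0 v] combine[of u v 0]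
      by cases (auto simp: S_def)
  qed
  ultimately show ?thesis by (rule that)
qed

text \<open>Lebesgue differentiation enters through averages over intervals to the right of a point.
  The averages to the left come from applying the same result to the reflected function
  \<open>\<lambda>t. g (- t)\<close>.\<close>

lemma primitive_has_real_derivative_ae:
  fixes g S :: "real \<Rightarrow> real"
  assumes g: "\<And>a b. g integrable_on {a..b}"
    and S: "\<And>u v. u \<le> v \<Longrightarrow> S v - S u = integral {u..v} g"
  obtains N where "negligible N" "\<And>t. t \<notin> N \<Longrightarrow> (S has_real_derivative g t) (at t)"
proof -
  have right: "\<exists>N. negligible N \<and> (\<forall>x e. x \<notin> N \<and> 0 < e \<longrightarrow>
      (\<exists>d>0. \<forall>h. 0 < h \<and> h < d \<longrightarrow> \<bar>integral {x..x + h} f / h - f x\<bar> < e))"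
    if f: "\<And>a b. f integrable_on {a..b}" for f :: "real \<Rightarrow> real"
  proof -
    obtain N where "negligible N" and N: "\<And>x e. \<lbrakk>x \<notin> N; 0 < e\<rbrakk> \<Longrightarrow> \<exists>d>0. \<forall>h. 0 < h \<and> h < d \<longrightarrow>
        norm (integral (cbox x (x + h *\<^sub>R One)) f /\<^sub>R h ^ DIM(real) - f x) < e"
      using integrable_ccontinuous_explicit[of f] f by auto
    then show ?thesis
      by (intro exI[of _ N]) (simp add: divide_inverse_commute)
  qed
  obtain N1 where N1: "negligible N1" "\<forall>x e. x \<notin> N1 \<and> 0 < e \<longrightarrow>
      (\<exists>d>0. \<forall>h. 0 < h \<and> h < d \<longrightarrow> \<bar>integral {x..x + h} g / h - g x\<bar> < e)"
    using right[OF g] by blast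
  have gm: "(\<lambda>t. g (- t)) integrable_on {a..b}" for a b
    using g[of "-b" "-a"] Henstock_Kurzweil_Integration.integrable_reflect_real[where a = "- b" and b = "- a" and f = g] by simp
  obtain N2 where N2: "negligible N2" "\<forall>x e. x \<notin> N2 \<and> 0 < e \<longrightarrow>
      (\<exists>d>0. \<forall>h. 0 < h \<and> h < d \<longrightarrow> \<bar>integral {x..x + h} (\<lambda>t. g (- t)) / h - g (- x)\<bar> < e)"
    using right[OF gm] by blast
  have refl_int: "integral {x..x + h} (\<lambda>t. g (- t)) = integral {- x - h..- x} g" for x h
    using Henstock_Kurzweil_Integration.integral_reflect_real[where a = "- x - h" and b = "- x" and f = g] by (simp add: add.commute)
  show ?thesis
  proof
    \<comment> \<open>The exceptional set of the reflected function has to be reflected back;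
      negation is differentiable and so preserves negligibility.\<close>
    show "negligible (N1 \<union> uminus ` N2)"
      using N1(1) N2(1) by (intro negligible_Un negligible_differentiable_image_negligible) auto
    fix t assume "t \<notin> N1 \<union> uminus ` N2"
    then have t1: "t \<notin> N1" and t2: "- t \<notin> N2"
      by (auto simp: image_iff)
    show "(S has_real_derivative g t) (at t)"
      unfolding has_field_derivative_iff LIM_eq
    proof (intro allI impI)
      fix e :: real assume "e > 0"
      obtain d1 where "d1 > 0" and d1: "\<And>h. \<lbrakk>0 < h; h < d1\<rbrakk> \<Longrightarrow> \<bar>integral {t..t + h} g / h - g t\<bar> < e"
        using N1(2)[THEN spec[of _ t], THEN spec[of _ e]] t1 \<open>e > 0\<close> by auto
      obtain d2 where "d2 > 0" and d2: "\<And>h. \<lbrakk>0 < h; h < d2\<rbrakk> \<Longrightarrow> \<bar>integral {t - h..t} g / h - g t\<bar> < e"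
        using N2(2)[THEN spec[of _ "- t"], THEN spec[of _ e]] t2 \<open>e > 0\<close> unfolding refl_int by auto
      show "\<exists>s>0. \<forall>x. x \<noteq> t \<and> norm (x - t) < s \<longrightarrow> norm ((S x - S t) / (x - t) - g t) < e"
      proof (intro exI[of _ "min d1 d2"] conjI allI impI)
        show "min d1 d2 > 0" using \<open>d1 > 0\<close> \<open>d2 > 0\<close> by simp
        fix x assume x: "x \<noteq> t \<and> norm (x - t) < min d1 d2"
        show "norm ((S x - S t) / (x - t) - g t) < e"
        proof (cases "x > t")
          case True
          then show ?thesis using d1[of "x - t"] x S[of t x] by simp
        next
          case False
          then have "(S x - S t) / (x - t) = integral {x..t} g / (t - x)"
            using x S[of x t] by (simp add: field_simps)
          then show ?thesis using d2[of "t - x"] x False by auto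
        qed
      qed
    qed
  qed
qed

section \<open>Null sets, continuity and periodicity\<close>

lemma AE_lebesgue_imp_negligible:
  assumes "AE t in lebesgue. P t"
  obtains N where "negligible N" "\<And>t. t \<notin> N \<Longrightarrow> P t"
proof -
  obtain N where "{t \<in> space lebesgue. \<not> P t} \<subseteq> N" "N \<in> null_sets lebesgue"
    using assms unfolding eventually_ae_filter by blast
  then show ?thesis
    by (intro that[of N]) (auto simp: negligible_iff_null_sets)
qed

lemma AE_lebesgue_negligible:
  assumes "negligible N" "\<And>t. t \<notin> N \<Longrightarrow> P t"
  shows "AE t in lebesgue. P t"
  by (rule AE_I'[of N]) (use assms in \<open>auto simp: negligible_iff_null_sets\<close>)

lemma locally_abs_continuous_imp_isCont:
  assumes "locally_abs_continuous f"
  shows "isCont f t"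
proof -
  have "continuous_on {t - 1..t + 1} f"
    using assms unfolding locally_abs_continuous_def
    by (intro abs_continuous_on_interval_imp_continuous_on) simp
  then show ?thesis
    by (rule continuous_on_interior) (simp add: interior_atLeastAtMost_real)
qed

lemma periodic_multiple:
  fixes f :: "real \<Rightarrow> 'a"
  assumes "\<And>t. f (t + T) = f t"
  shows "f (t + real n * T) = f t"
proof (induction n)
  case (Suc n)
  have "f (t + real (Suc n) * T) = f ((t + real n * T) + T)" by (simp add: algebra_simps)
  then show ?case using Suc assms by simp
qed simp

lemma periodic_integrable_on:
  fixes f :: "real \<Rightarrow> real"
  assumes "T > 0" and per: "\<And>t. f (t + T) = f t" and f: "f integrable_on {0..T}"
  shows "f integrable_on {a..b}"
proof -
  have shift: "(\<lambda>t. f (t + real n * T)) = f" for n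
    using periodic_multiple[of f T] per by (intro ext) blast
  have pos: "f integrable_on {0..real n * T}" for n
  proof (induction n)
    case (Suc n)
    have "(\<lambda>t. f (t + - T)) integrable_on {0 - - T..real n * T - - T}"
      by (rule integrable_shift_real_ivl[OF Suc])
    moreover have "(\<lambda>t. f (t + - T)) = f"
    proof
      show "f (t + - T) = f t" for t using per[of "t - T"] by simp
    qed
    moreover have "0 - - T = T" "real n * T - - T = real (Suc n) * T"
      by (simp_all add: algebra_simps)
    ultimately have "f integrable_on {T..real (Suc n) * T}"
      by (simp only:)
    then show ?case
      using f \<open>T > 0\<close>
      by (intro Henstock_Kurzweil_Integration.integrable_combine[of 0 T "real (Suc n) * T" f]) simp_all
  qed (use integrable_on_refl[of f "0::real"] in simp)
  obtain n :: nat where "max (- a) b / T \<le> real n" using real_arch_simple by blast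
  then have "max (- a) b \<le> real n * T" using pos_divide_le_eq[OF \<open>T > 0\<close>] by blast
  then have n: "- (real n * T) \<le> a" "b \<le> real n * T" by linarith+
  \<comment> \<open>A shift by \<open>n\<close> periods carries \<open>{0..2 * n * T}\<close> to a
    window symmetric about 0, so gluing was needed only to the right of 0.\<close>
  have "(\<lambda>t. f (t + real n * T)) integrable_on {0 - real n * T..real (2 * n) * T - real n * T}"
    by (rule integrable_shift_real_ivl[OF pos])
  moreover have "0 - real n * T = - (real n * T)" "real (2 * n) * T - real n * T = real n * T"
    by (simp_all add: algebra_simps)
  ultimately have "f integrable_on {- (real n * T)..real n * T}"
    by (simp only: shift)
  moreover have "{a..b} \<subseteq> {- (real n * T)..real n * T}"
    using n by simp
  ultimately show ?thesis
    by (rule integrable_subinterval_real)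
qed

lemma periodic_eq_const:
  fixes f :: "real \<Rightarrow> 'a"
  assumes "T > 0" and per: "\<And>t. f (t + T) = f t" and c: "\<And>t. t \<in> {0..T} \<Longrightarrow> f t = c"
  shows "f t = c"
proof -
  obtain n :: nat where "- t / T \<le> real n" using real_arch_simple by blast
  then have n: "- t \<le> real n * T" using pos_divide_le_eq[OF \<open>T > 0\<close>] by blast
  \<comment> \<open>Only natural multiples of the period are at hand. So \<open>t\<close> is first
    moved to a nonnegative \<open>s\<close>, and then whole periods are taken off by a
    floor.\<close>
  define s where "s = t + real n * T"
  have "s \<ge> 0" using n by (simp add: s_def)
  define m where "m = nat \<lfloor>s / T\<rfloor>"
  have "s / T \<ge> 0" using \<open>s \<ge> 0\<close> \<open>T > 0\<close> by simp
  then have "real m \<le> s / T" "s / T < real m + 1"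
    unfolding m_def by simp_all
  then have "real m * T \<le> s" "s < (real m + 1) * T"
    using \<open>T > 0\<close> by (simp_all add: pos_le_divide_eq pos_divide_less_eq)
  then have "s - real m * T \<in> {0..T}"
    by (simp add: distrib_right)
  then have "f (s - real m * T) = c" by (rule c)
  moreover have "f s = f (s - real m * T)"
    using periodic_multiple[of f T "s - real m * T" m] per by simp
  moreover have "f s = f t"
    unfolding s_def using periodic_multiple[of f T t n] per by blast
  ultimately show ?thesis by simp
qed

section \<open>Uniqueness of the periodic solution by a maximum argument\<close>

lemma periodic_solution_le:
  assumes lam: "lam > 0" and T: "T > 0" and pos: "\<And>t. \<sigma> t \<ge> 0"
    and x: "periodic_solution lam T \<sigma> x" and y: "periodic_solution lam T \<sigma> y"
  shows "x t0 \<le> y t0"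
proof (rule ccontr)
  assume "\<not> x t0 \<le> y t0"
  define z where "z t = x t - y t" for t
  have z0: "z t0 > 0" using \<open>\<not> x t0 \<le> y t0\<close> by (simp add: z_def)
  have per: "z (t + T) = z t" for t
    using x y by (simp add: z_def periodic_solution_def)
  have lac: "locally_abs_continuous z"
    using x y unfolding z_def periodic_solution_def bottleneck_solution_def locally_abs_continuous_def
    by (blast intro: abs_continuous_on_interval_diff)
  have cont: "isCont z t" for t by (rule locally_abs_continuous_imp_isCont[OF lac])
  have "AE t in lebesgue. (z has_real_derivative - (\<sigma> t + lam) * z t) (at t)"
  proof -
    have "AE t in lebesgue. (x has_real_derivative \<sigma> t * (1 - x t) - lam * x t) (at t)"
      "AE t in lebesgue. (y has_real_derivative \<sigma> t * (1 - y t) - lam * y t) (at t)"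
      using x y unfolding periodic_solution_def bottleneck_solution_def by auto
    then show ?thesis
    proof eventually_elim
      case (elim t)
      have "(z has_real_derivative (\<sigma> t * (1 - x t) - lam * x t) - (\<sigma> t * (1 - y t) - lam * y t)) (at t)"
        unfolding z_def by (rule DERIV_diff[OF elim])
      moreover have "(\<sigma> t * (1 - x t) - lam * x t) - (\<sigma> t * (1 - y t) - lam * y t) = - (\<sigma> t + lam) * z t"
        by (simp add: z_def algebra_simps)
      ultimately show ?case by simp
    qed
  qed
  then obtain N where N: "negligible N"
    and der: "\<And>t. t \<notin> N \<Longrightarrow> (z has_real_derivative - (\<sigma> t + lam) * z t) (at t)"
    using AE_lebesgue_imp_negligible by blast
  have "\<exists>m\<in>{t0 - T..t0}. \<forall>t\<in>{t0 - T..t0}. z t \<le> z m"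
    using T cont by (intro continuous_attains_sup) (auto intro: continuous_at_imp_continuous_on)
  then obtain m' where m': "m' \<in> {t0 - T..t0}" "\<And>t. t \<in> {t0 - T..t0} \<Longrightarrow> z t \<le> z m'" by blast
  \<comment> \<open>The argument looks to the left of the maximum. If it sits at the left end of the
    window, periodicity moves it to the right end.\<close>
  define m where "m = (if m' = t0 - T then t0 else m')"
  have m: "t0 - T < m" "m \<le> t0" using m'(1) T by (auto simp: m_def)
  have "z m = z m'" using per[of "t0 - T"] by (simp add: m_def)
  then have zm: "z t \<le> z m" if "t \<in> {t0 - T..t0}" for t using m'(2) that by simp
  have zmpos: "z m > 0" using zm[of t0] z0 T by simp
  obtain d0 where d0: "d0 > 0" "\<And>t. \<bar>t - m\<bar> < d0 \<Longrightarrow> \<bar>z t - z m\<bar> < z m"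
    using cont[of m] zmpos unfolding continuous_at_eps_delta dist_real_def by blast
  \<comment> \<open>Halving \<open>d0\<close> keeps \<open>z\<close> positive on the closed interval
    from \<open>m - d\<close> to \<open>m\<close>; the other bound keeps that interval inside the
    window where \<open>z m\<close> is maximal.\<close>
  define d where "d = min (d0 / 2) (m - (t0 - T))"
  have d: "d > 0" "d < d0" "m - d \<ge> t0 - T"
    using d0(1) m by (auto simp: d_def)
  have zpos: "z t > 0" if "t \<in> {m - d..m}" for t
    using d0(2)[of t] that d by auto
  have const: "z s = z m" if s: "s \<in> {m - d..m}" for s
  proof (rule antisym)
    show "z s \<le> z m" using zm[of s] s d m by simp
    show "z m \<le> z s"
    proof (rule abs_continuous_nonincreasing[where f = z and a = s and b = m, OF _ _ N])
      show "abs_continuous_on_interval s m z" "s \<le> m"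
        using lac s unfolding locally_abs_continuous_def by auto
      fix t assume t: "t \<in> {s..m} - N"
      have "(\<sigma> t + lam) * z t \<ge> 0"
        using pos[of t] lam zpos[of t] s t by simp
      then show "\<exists>D\<le>0. (z has_real_derivative D) (at t)"
        using der[of t] t by (intro exI[of _ "- (\<sigma> t + lam) * z t"]) (simp del: minus_add_distrib)
    qed
  qed
  \<comment> \<open>A nonempty open interval is not negligible, so the equation holds somewhere in
    it; there the constant \<open>z\<close> would have a strictly negative derivative.\<close>
  have "\<not> {m - d<..<m} \<subseteq> N"
    using N d(1) negligible_subset[of N "{m - d<..<m}"] open_not_negligible[of "{m - d<..<m}"] by auto
  then obtain s where s: "s \<in> {m - d<..<m}" "s \<notin> N" by blast
  have "((\<lambda>_. z m) has_real_derivative - (\<sigma> s + lam) * z s) (at s)"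
  proof (rule has_field_derivative_transform_within_open[OF der[OF s(2)]])
    show "open {m - d<..<m}" "s \<in> {m - d<..<m}" using s by auto
    show "z t = z m" if "t \<in> {m - d<..<m}" for t
      by (rule const) (use that in auto)
  qed
  then have "- (\<sigma> s + lam) * z s = 0"
    using DERIV_unique[OF _ DERIV_const] by blast
  moreover have "(\<sigma> s + lam) * z s > 0"
    using pos[of s] lam zpos[of s] s by simp
  ultimately show False by auto
qed

lemma periodic_solution_unique:
  assumes "lam > 0" "T > 0" "\<And>t. \<sigma> t \<ge> 0"
    and "periodic_solution lam T \<sigma> x" "periodic_solution lam T \<sigma> y"
  shows "x = y"
proof (intro ext antisym)
  fix t
  show "x t \<le> y t" by (rule periodic_solution_le[OF assms])
  show "y t \<le> x t" by (rule periodic_solution_le[OF assms(1-3) assms(5,4)])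
qed

section \<open>Existence of the periodic solution by variation of constants\<close>

text \<open>It is applied to \<open>exp (S t)\<close>, which is continuous although \<open>S\<close>
  itself is differentiable only almost everywhere. The derivative at every point opens the mean
  value theorem and the classical fundamental theorem.\<close>

lemma continuous_antiderivative_exists:
  fixes f :: "real \<Rightarrow> real"
  assumes "\<And>t. isCont f t"
  obtains F where "F 0 = 0" "\<And>t. (F has_real_derivative f t) (at t)"
proof -
  obtain F where "\<forall>x::real. - \<infinity> < ereal x \<longrightarrow> ereal x < \<infinity> \<longrightarrow> (F has_vector_derivative f x) (at x)"
    using einterval_antiderivative[of "- \<infinity>" \<infinity> f] assms by auto
  then have F: "(F has_real_derivative f t) (at t)" for t
    by (simp add: has_real_derivative_iff_has_vector_derivative)
  show ?thesis
  proof (rule that[of "\<lambda>t. F t - F 0"])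
    show "F 0 - F 0 = 0" by simp
    show "((\<lambda>t. F t - F 0) has_real_derivative f t) (at t)" for t
      using DERIV_diff[OF F[of t] DERIV_const[of "F 0"]] by simp
  qed
qed

text \<open>Besides the solution \<open>1 - y\<close>, the lemma records the integral of
  \<open>lam / y\<close>, which turns the bound on the mean of \<open>y\<close> into a statement
  about the mean of \<open>\<sigma>\<close>.\<close>

lemma periodic_solution_exists:
  assumes lam: "lam > 0" and T: "T > 0" and pos: "\<And>t. \<sigma> t \<ge> 0" and per: "\<And>t. \<sigma> (t + T) = \<sigma> t"
    and \<sigma>: "\<sigma> integrable_on {0..T}"
  obtains y where "periodic_solution lam T \<sigma> (\<lambda>t. 1 - y t)" "continuous_on {0..T} y"
    "\<And>t. t \<in> {0..T} \<Longrightarrow> y t > 0"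
    "((\<lambda>t. lam / y t) has_integral integral {0..T} \<sigma> + lam * T) {0..T}"
proof -
  define g where "g t = \<sigma> t + lam" for t
  have gpos: "g t \<ge> lam" "g t \<ge> 0" for t using pos[of t] lam by (auto simp: g_def)
  have gper: "g (t + T) = g t" for t by (simp add: g_def per)
  have gT: "(g has_integral integral {0..T} \<sigma> + lam * T) {0..T}"
    unfolding g_def using has_integral_add[OF integrable_integral[OF \<sigma>] has_integral_const_real[of lam 0 T]] T
    by (simp add: mult.commute)
  then have "g integrable_on {0..T}" by (rule has_integral_integrable)
  have gint: "g integrable_on {a..b}" for a b
    using periodic_integrable_on[OF T gper \<open>g integrable_on {0..T}\<close>] .
  obtain S where S0: "S 0 = 0" and S: "\<And>u v. u \<le> v \<Longrightarrow> S v - S u = integral {u..v} g"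
    using primitive_exists[of g] gint by blast
  have ST: "S T = integral {0..T} \<sigma> + lam * T"
    using S[of 0 T] T S0 integral_unique[OF gT] by simp
  \<comment> \<open>Since \<open>g\<close> is at least \<open>lam\<close>, increments of
    \<open>S\<close> dominate \<open>lam * (v - u)\<close>. This gives \<open>S T > 0\<close> and
    lets Lipschitz bounds be absorbed into increments of \<open>S\<close>.\<close>
  have Sinc: "S v - S u \<ge> lam * (v - u)" if "u \<le> v" for u v
  proof -
    have "integral {u..v} (\<lambda>_. lam) \<le> integral {u..v} g"
      using gint gpos by (intro integral_le) auto
    then show ?thesis using S[OF that] that by (simp add: mult.commute)
  qed
  have Smono: "S u \<le> S v" if "u \<le> v" for u v
    using Sinc[OF that] that lam by (smt (verit) mult_nonneg_nonneg)
  have Sac: "abs_continuous_on_interval a b S" for a b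
    by (rule abs_continuous_primitive[OF gint gpos(2)]) (rule S)
  then have Scont: "isCont S t" for t
    by (intro locally_abs_continuous_imp_isCont) (simp add: locally_abs_continuous_def)
  have shift: "integral {u + T..v + T} g = integral {u..v} g" for u v
    using integral_shift_real_ivl[of "u + T" T "v + T" g] by (simp add: gper)
  have Sper: "S (t + T) = S t + S T" for t
  proof (cases "0 \<le> t")
    case True
    then show ?thesis using shift[of 0 t] S[of 0 t] S[of T "t + T"] S0 by simp
  next
    case False
    then show ?thesis using shift[of t 0] S[of t 0] S[of "t + T" T] S0 by simp
  qed
  have STpos: "S T > 0" using Sinc[of 0 T] S0 T mult_pos_pos[OF lam T] by simp
  obtain H where H0: "H 0 = 0" and H: "\<And>t. (H has_real_derivative exp (S t)) (at t)"
    using continuous_antiderivative_exists[of "\<lambda>t. exp (S t)"] Scont by (auto intro: isCont_exp')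
  have Hmono: "0 \<le> H v - H u \<and> H v - H u \<le> exp (S v) * (v - u)" if "u \<le> v" for u v
  proof (cases "u = v")
    case False
    then obtain z where "u < z" "z < v" "H v - H u = (v - u) * exp (S z)"
      using MVT2[of u v H "\<lambda>t. exp (S t)"] H \<open>u \<le> v\<close> by (auto simp: less_le)
    then show ?thesis using Smono[of z v] that by (auto simp: mult.commute intro!: mult_left_mono)
  qed simp
  \<comment> \<open>Both sides have the same derivative because \<open>S\<close> grows by
    \<open>S T\<close> over a period, and they agree at 0.\<close>
  have Hper: "H (t + T) = H T + exp (S T) * H t" for t
  proof -
    have "((\<lambda>t. H (t + T) - exp (S T) * H t) has_real_derivative 0) (at t)" for t
    proof -
      have "((\<lambda>t. H (t + T)) has_real_derivative exp (S (t + T))) (at t)"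
        using H[of "t + T"] by (simp add: DERIV_shift)
      moreover have "((\<lambda>t. exp (S T) * H t) has_real_derivative exp (S T) * exp (S t)) (at t)"
        by (rule DERIV_cmult[OF H])
      ultimately have "((\<lambda>t. H (t + T) - exp (S T) * H t) has_real_derivative
          exp (S (t + T)) - exp (S T) * exp (S t)) (at t)"
        by (rule DERIV_diff)
      then show ?thesis by (simp add: Sper exp_add)
    qed
    then have "H (t + T) - exp (S T) * H t = H (0 + T) - exp (S T) * H 0"
      by (intro DERIV_isconst_all) blast
    then show ?thesis by (simp add: H0)
  qed
  \<comment> \<open>\<open>D\<close> is the initial value of \<open>y\<close>, found by solving
    \<open>D + lam * H T = exp (S T) * D\<close>, the condition that \<open>y\<close> returns to it
    after one period.\<close>
  define D where "D = lam * H T / (exp (S T) - 1)"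
  have HT: "H T > 0"
  proof -
    obtain z where "0 < z" "z < T" "H T - H 0 = (T - 0) * exp (S z)"
      using MVT2[of 0 T H "\<lambda>t. exp (S t)"] H T by auto
    then show ?thesis using T H0 by simp
  qed
  have D: "D > 0" "D + lam * H T = exp (S T) * D"
  proof -
    have "exp (S T) - 1 > 0" using STpos by simp
    then show "D > 0" using HT lam by (simp add: D_def)
    have "D * (exp (S T) - 1) = lam * H T"
      unfolding D_def using \<open>exp (S T) - 1 > 0\<close> by simp
    then show "D + lam * H T = exp (S T) * D" by (simp add: algebra_simps)
  qed
  define P where "P t = D + lam * H t" for t
  have Pder: "(P has_real_derivative lam * exp (S t)) (at t)" for t
    unfolding P_def using DERIV_add[OF DERIV_const[of D] DERIV_cmult[OF H[of t], of lam]] by simp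
  have Pper: "P (t + T) = exp (S T) * P t" for t
    unfolding P_def Hper using D(2) by (simp add: algebra_simps)
  have Ppos: "P t > 0" if "t \<in> {0..T}" for t
    using Hmono[of 0 t] that D(1) lam H0 by (auto simp: P_def intro: add_pos_nonneg)
  have Pcont: "isCont P t" for t using Pder by (rule DERIV_isCont)
  define y where "y t = exp (- S t) * P t" for t
  have ycont: "isCont y t" for t
    unfolding y_def using Scont Pcont by (intro continuous_intros) auto
  have yper: "y (t + T) = y t" for t
  proof -
    have "y (t + T) = exp (- S t + - S T) * (exp (S T) * P t)"
      unfolding y_def Sper Pper by simp
    also have "\<dots> = exp (- S t) * (exp (- S T) * exp (S T)) * P t"
      by (simp only: exp_add mult.assoc)
    also have "exp (- S T) * exp (S T) = 1" by (simp flip: exp_add)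
    finally show ?thesis by (simp add: y_def)
  qed
  have yac: "abs_continuous_on_interval a b (\<lambda>t. 1 - y t)" if "a \<le> b" for a b
  proof -
    have "\<exists>M. \<forall>t. a \<le> t \<and> t \<le> b \<longrightarrow> \<bar>P t\<bar> \<le> M"
    proof -
      have "\<exists>M. \<forall>t. a \<le> t \<and> t \<le> b \<longrightarrow> (\<lambda>t. \<bar>P t\<bar>) t \<le> M"
        using Pcont by (intro isCont_bounded[OF that]) (auto intro: continuous_intros)
      then show ?thesis by simp
    qed
    then obtain M where M: "\<And>t. \<lbrakk>a \<le> t; t \<le> b\<rbrakk> \<Longrightarrow> \<bar>P t\<bar> \<le> M" by blast
    show ?thesis
    \<comment> \<open>The increment of the product \<open>exp (- S) * P\<close> is split as in the
      product rule. In the first part the exponentials cancel, leaving at most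
      \<open>lam * (v - u)\<close>. In the second,
      \<open>1 - exp (- \<Delta>) \<le> \<Delta>\<close>, the bound \<open>M\<close> on
      \<open>P\<close> and the monotonicity of \<open>S\<close> give the remaining constant.\<close>
    proof (rule abs_continuous_on_interval_dominated[OF Sac, of _ _ _ "1 + M * exp (- S a)"])
      fix u v assume uv: "a \<le> u" "u \<le> v" "v \<le> b"
      define \<Delta> where "\<Delta> = S v - S u"
      have \<Delta>: "\<Delta> \<ge> 0" "\<Delta> \<ge> lam * (v - u)" using Smono[OF uv(2)] Sinc[OF uv(2)] by (auto simp: \<Delta>_def)
      have "\<bar>exp (- S v) * (P v - P u)\<bar> \<le> \<Delta>"
      proof -
        have "P v - P u = lam * (H v - H u)"
          by (simp add: P_def right_diff_distrib)
        then have "\<bar>exp (- S v) * (P v - P u)\<bar> = exp (- S v) * (lam * (H v - H u))"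
          using Hmono[OF uv(2)] lam by (simp add: abs_mult)
        also have "\<dots> \<le> exp (- S v) * (lam * (exp (S v) * (v - u)))"
          using Hmono[OF uv(2)] lam by (intro mult_left_mono) auto
        also have "\<dots> = lam * (v - u)"
          by (simp add: exp_minus)
        finally show ?thesis using \<Delta> by simp
      qed
      moreover have "\<bar>(exp (- S v) - exp (- S u)) * P u\<bar> \<le> M * exp (- S a) * \<Delta>"
      proof -
        have "exp (- S u) - exp (- S v) = exp (- S u) * (1 - exp (- \<Delta>))"
          by (simp add: \<Delta>_def right_diff_distrib flip: exp_add)
        moreover have "1 - exp (- \<Delta>) \<le> \<Delta>" using exp_ge_add_one_self[of "- \<Delta>"] by simp
        moreover have "1 - exp (- \<Delta>) \<ge> 0" using \<Delta> by simp
        moreover have "exp (- S u) \<le> exp (- S a)" using Smono[OF uv(1)] by simp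
        ultimately have "0 \<le> exp (- S u) - exp (- S v)" "exp (- S u) - exp (- S v) \<le> exp (- S a) * \<Delta>"
          by (auto intro!: mult_mono)
        then have "\<bar>exp (- S v) - exp (- S u)\<bar> * \<bar>P u\<bar> \<le> (exp (- S a) * \<Delta>) * M"
          using M[of u] uv \<Delta>(1) by (intro mult_mono) auto
        then show ?thesis by (simp add: abs_mult mult_ac)
      qed
      moreover have "(1 - y v) - (1 - y u) = - (exp (- S v) * (P v - P u)) - (exp (- S v) - exp (- S u)) * P u"
        by (simp add: y_def algebra_simps)
      ultimately have "\<bar>(1 - y v) - (1 - y u)\<bar> \<le> \<Delta> + M * exp (- S a) * \<Delta>"
        by linarith
      then show "\<bar>(1 - y v) - (1 - y u)\<bar> \<le> (1 + M * exp (- S a)) * \<bar>S v - S u\<bar>"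
        using \<Delta>(1) by (simp add: distrib_right flip: \<Delta>_def)
    qed
  qed
  have yder: "((\<lambda>t. 1 - y t) has_real_derivative \<sigma> t * (1 - (1 - y t)) - lam * (1 - y t)) (at t)"
    if S': "(S has_real_derivative g t) (at t)" for t
  proof -
    have "((\<lambda>t. exp (- S t)) has_real_derivative exp (- S t) * - g t) (at t)"
      by (rule DERIV_fun_exp[OF DERIV_minus[OF S']])
    from DERIV_mult[OF this Pder[of t]]
    have "(y has_real_derivative exp (- S t) * - g t * P t + lam * exp (S t) * exp (- S t)) (at t)"
      unfolding y_def .
    moreover have "lam * exp (S t) * exp (- S t) = lam" by (simp add: exp_minus)
    moreover have "exp (- S t) * - g t * P t = - g t * y t" by (simp add: y_def)
    ultimately have "(y has_real_derivative - g t * y t + lam) (at t)" by (simp only:)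
    from DERIV_diff[OF DERIV_const[of 1] this]
    have "((\<lambda>t. 1 - y t) has_real_derivative 0 - (- g t * y t + lam)) (at t)" .
    moreover have "0 - (- g t * y t + lam) = \<sigma> t * (1 - (1 - y t)) - lam * (1 - y t)"
      by (simp add: g_def algebra_simps)
    ultimately show ?thesis by (simp only:)
  qed
  obtain N where N: "negligible N" "\<And>t. t \<notin> N \<Longrightarrow> (S has_real_derivative g t) (at t)"
    using primitive_has_real_derivative_ae[of g S] gint S by blast
  have sol: "periodic_solution lam T \<sigma> (\<lambda>t. 1 - y t)"
    unfolding periodic_solution_def bottleneck_solution_def locally_abs_continuous_def
  proof (intro conjI allI impI)
    show "AE t in lebesgue. ((\<lambda>t. 1 - y t) has_real_derivative \<sigma> t * (1 - (1 - y t)) - lam * (1 - y t)) (at t)"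
      by (rule AE_lebesgue_negligible[OF N(1)]) (rule yder[OF N(2)])
  qed (use yac yper in simp_all)
  \<comment> \<open>The integrand is the derivative of \<open>ln P\<close>, not of
    \<open>ln y\<close>. As \<open>P\<close> is differentiable at every point, the fundamental
    theorem applies with no exceptional set, and periodicity of \<open>y\<close> makes the increment
    of \<open>ln P\<close> equal to \<open>S T\<close>.\<close>
  have "((\<lambda>t. lam / y t) has_integral ln (P T) - ln (P 0)) {0..T}"
  proof (rule fundamental_theorem_of_calculus)
    show "0 \<le> T" using T by simp
    fix t assume t: "t \<in> {0..T}"
    have "((\<lambda>t. ln (P t)) has_real_derivative lam * exp (S t) / P t) (at t)"
      using DERIV_chain2[OF DERIV_ln[OF Ppos[OF t]] Pder[of t]] by (simp add: field_simps)
    moreover have "lam * exp (S t) / P t = lam / y t"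
      by (simp add: y_def exp_minus field_simps)
    ultimately show "((\<lambda>t. ln (P t)) has_vector_derivative lam / y t) (at t within {0..T})"
      by (simp add: has_real_derivative_iff_has_vector_derivative has_vector_derivative_at_within)
  qed
  moreover have "ln (P T) - ln (P 0) = S T"
    using Pper[of 0] Ppos[of 0] T by (simp add: ln_mult)
  ultimately have "((\<lambda>t. lam / y t) has_integral integral {0..T} \<sigma> + lam * T) {0..T}"
    by (simp add: ST)
  moreover have "y t > 0" if "t \<in> {0..T}" for t
    using Ppos[OF that] by (simp add: y_def)
  moreover have "continuous_on {0..T} y"
    using ycont by (simp add: continuous_at_imp_continuous_on)
  ultimately show ?thesis using sol by (intro that)
qed

section \<open>Evaluation of \<open>w\<close> and the mean inequality\<close>

lemma x_p_eqI:
  assumes "lam > 0" "T > 0" "\<And>t. \<sigma> t \<ge> 0" and x: "periodic_solution lam T \<sigma> x"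
  shows "x_p lam T \<sigma> = x"
  unfolding x_p_def
proof (rule the_equality)
  show "periodic_solution lam T \<sigma> x" by (rule x)
  show "z = x" if "periodic_solution lam T \<sigma> z" for z
    by (rule periodic_solution_unique[OF assms(1-3) that x])
qed

lemma period_mean_continuous:
  assumes "continuous_on {0..T} f"
  shows "period_mean T f = integral {0..T} f / T"
proof -
  have "set_integrable lebesgue {0..T} f"
    by (rule absolutely_integrable_continuous_real[OF assms])
  then show ?thesis
    by (simp add: period_mean_def set_lebesgue_integral_eq_integral(2))
qed

lemma periodic_solution_const:
  assumes "lam + m \<noteq> 0"
  shows "periodic_solution lam T (\<lambda>_. m) (\<lambda>_. m / (lam + m))"
proof -
  have "m * (1 - m / (lam + m)) - lam * (m / (lam + m)) = 0"
    using assms by (simp add: field_simps)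
  then show ?thesis
    by (simp add: periodic_solution_def bottleneck_solution_def locally_abs_continuous_def
        abs_continuous_on_interval_def exI[of _ "1::real"])
qed

text \<open>The arithmetic mean is at least the harmonic mean, here \<open>lam * T / G\<close>: the
  function \<open>(y - c)\<^sup>2 / y\<close> is nonnegative and its integral is that of
  \<open>y\<close> minus \<open>c * T\<close>. In the equality case this continuous function has
  zero integral, so it vanishes at every point.\<close>

lemma integral_ge_of_integral_inverse:
  fixes y :: "real \<Rightarrow> real"
  assumes T: "T > 0" and lam: "lam > 0" and G: "G > 0"
    and cont: "continuous_on {0..T} y" and pos: "\<And>t. t \<in> {0..T} \<Longrightarrow> y t > 0"
    and inv: "((\<lambda>t. lam / y t) has_integral G) {0..T}"
  shows "integral {0..T} y \<ge> lam * T / G * T"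
    and "integral {0..T} y = lam * T / G * T \<Longrightarrow> t \<in> {0..T} \<Longrightarrow> y t = lam * T / G"
proof -
  define c where "c = lam * T / G"
  \<comment> \<open>This is the expanded form of \<open>(y t - c)\<^sup>2 / y t\<close>, arranged so
    that the known integral of \<open>lam / y\<close> can be inserted.\<close>
  define f where "f t = y t + c\<^sup>2 / lam * (lam / y t) - 2 * c" for t
  have feq: "f t = (y t - c)\<^sup>2 / y t" if "t \<in> {0..T}" for t
    using pos[OF that] lam by (simp add: f_def field_simps power2_eq_square)
  then have fnn: "f t \<ge> 0" if "t \<in> {0..T}" for t
    using pos[OF that] that by simp
  have "(y has_integral integral {0..T} y) {0..T}"
    by (intro integrable_integral integrable_continuous_real cont)
  then have "(f has_integral integral {0..T} y + c\<^sup>2 / lam * G - (T - 0) * (2 * c)) {0..T}"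
    unfolding f_def using T
    by (intro has_integral_diff has_integral_add has_integral_mult_right inv) (use has_integral_const_real[of "2 * c" 0 T] in auto)
  moreover have "c\<^sup>2 / lam * G = c * T"
    using lam G by (simp add: c_def power2_eq_square)
  ultimately have f: "(f has_integral integral {0..T} y - c * T) {0..T}"
    by (simp add: algebra_simps)
  show "integral {0..T} y \<ge> lam * T / G * T"
    using has_integral_nonneg[OF f fnn] by (simp add: c_def)
  assume "integral {0..T} y = lam * T / G * T" and t: "t \<in> {0..T}"
  then have "integral {0..T} f = 0" using integral_unique[OF f] by (simp add: c_def)
  moreover have "continuous_on {0..T} f"
    unfolding f_def using pos by (intro continuous_intros cont) force+
  ultimately have "f t = 0"
    using integral_eq_0_iff[of 0 T f] T fnn t by simp
  then show "y t = lam * T / G"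
    using feq[OF t] pos[OF t] by (simp add: c_def)
qed

theorem theorem1:
  fixes lam T :: real and \<sigma> :: "real \<Rightarrow> real"
  assumes "lam > 0" and "T > 0"
    and "\<And>t. \<sigma> t \<ge> 0"
    and "\<And>t. \<sigma> (t + T) = \<sigma> t"
    and "set_integrable lebesgue {0..T} \<sigma>"
  shows "(\<exists>!x. periodic_solution lam T \<sigma> x)
    \<and> w lam T \<sigma> \<le> w lam T (\<lambda>_. period_mean T \<sigma>)
    \<and> w lam T (\<lambda>_. period_mean T \<sigma>) = lam * period_mean T \<sigma> / (lam + period_mean T \<sigma>)
    \<and> (w lam T \<sigma> = w lam T (\<lambda>_. period_mean T \<sigma>) \<longrightarrow>
         (AE t in lebesgue. \<sigma> t = period_mean T \<sigma>))"
proof -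
  note lam = assms(1) and T = assms(2) and pos = assms(3) and per = assms(4)
  define m where "m = period_mean T \<sigma>"
  note \<sigma>int = set_lebesgue_integral_eq_integral[OF assms(5)]
  have m: "integral {0..T} \<sigma> = m * T"
    using T by (simp add: m_def period_mean_def \<sigma>int(2))
  have "integral {0..T} \<sigma> \<ge> 0" by (intro integral_nonneg \<sigma>int(1) pos)
  then have mpos: "m \<ge> 0" using m T by (simp add: zero_le_mult_iff)
  have lm: "lam + m > 0" using lam mpos by simp
  define G where "G = integral {0..T} \<sigma> + lam * T"
  have G: "G = (lam + m) * T" by (simp add: G_def m algebra_simps)
  have Gpos: "G > 0" using G lm T by simp
  \<comment> \<open>\<open>c\<close> is the vacancy \<open>1 - x\<close> of the constant solution
    for inflow \<open>m\<close>, and also the harmonic mean of \<open>y\<close>.\<close>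
  define c where "c = lam / (lam + m)"
  have c: "lam * T / G = c" using T by (simp add: G c_def)
  obtain y where sol: "periodic_solution lam T \<sigma> (\<lambda>t. 1 - y t)" and cont: "continuous_on {0..T} y"
    and ypos: "\<And>t. t \<in> {0..T} \<Longrightarrow> y t > 0" and inv: "((\<lambda>t. lam / y t) has_integral G) {0..T}"
    using periodic_solution_exists[where \<sigma> = \<sigma>, OF lam T pos per \<sigma>int(1)] unfolding G_def by blast
  have ex1: "\<exists>!x. periodic_solution lam T \<sigma> x"
    using sol periodic_solution_unique[where \<sigma> = \<sigma>, OF lam T pos] by blast
  have "integral {0..T} (\<lambda>t. 1 - y t) = T - integral {0..T} y"
    using T cont by (subst integral_diff) (auto intro: integrable_continuous_real)
  then have w\<sigma>: "w lam T \<sigma> = lam * (1 - integral {0..T} y / T)"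
    using T cont by (simp add: w_def x_p_eqI[where \<sigma> = \<sigma>, OF lam T pos sol] period_mean_continuous
        continuous_on_diff diff_divide_distrib)
  have wm: "w lam T (\<lambda>_. m) = lam * (m / (lam + m))"
    using T mpos lm by (simp add: w_def x_p_eqI[OF lam T _ periodic_solution_const] period_mean_continuous)
  have mc: "m / (lam + m) = 1 - c" using lm by (simp add: c_def field_simps)
  have "integral {0..T} y \<ge> c * T"
    using integral_ge_of_integral_inverse(1)[OF T lam Gpos cont ypos inv] by (simp only: c)
  then have "c \<le> integral {0..T} y / T" using T by (simp add: pos_le_divide_eq)
  then have le: "w lam T \<sigma> \<le> w lam T (\<lambda>_. m)"
    unfolding w\<sigma> wm mc using lam by simp
  have eq: "AE t in lebesgue. \<sigma> t = m" if "w lam T \<sigma> = w lam T (\<lambda>_. m)"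
  proof -
    have "integral {0..T} y / T = c"
      using that lam unfolding w\<sigma> wm mc by simp
    then have "integral {0..T} y = c * T" using T by (simp add: field_simps)
    then have y0T: "y t = c" if "t \<in> {0..T}" for t
      using integral_ge_of_integral_inverse(2)[OF T lam Gpos cont ypos inv _ that] by (simp only: c)
    have "y (t + T) = y t" for t
      using sol by (simp add: periodic_solution_def)
    \<comment> \<open>Extending the constancy from one period to the line makes the derivative zero
      at every point. The equation then reads \<open>\<sigma> t * c = lam * (1 - c)\<close> for
      almost every \<open>t\<close>, which determines \<open>\<sigma> t\<close> as
      \<open>m\<close>.\<close>
    then have yc: "y t = c" for t
      using periodic_eq_const[where f = y, OF T _ y0T] by blast
    have "AE t in lebesgue. ((\<lambda>t. 1 - y t) has_real_derivative \<sigma> t * (1 - (1 - y t)) - lam * (1 - y t)) (at t)"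
      using sol unfolding periodic_solution_def bottleneck_solution_def by blast
    then show ?thesis
    proof eventually_elim
      case (elim t)
      then have "\<sigma> t * c - lam * (1 - c) = 0"
        unfolding yc using DERIV_unique[OF _ DERIV_const] by fastforce
      then show ?case
        using lam lm by (simp add: c_def divide_simps)
    qed
  qed
  show ?thesis
    using ex1 le eq wm by (simp flip: m_def)
qed

end
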